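(* Let $X$ be an upper compactly convex subset of a linear topological space $L$. Then the closure of $X$ in $L$ is metrizable if and only if each compact subset of $X$ is metrizable.
   Context: Linear topological spaces are over the reals and Hausdorff. For a topological space $X$, $\exp(X)$ denotes the set of all non-empty compact subsets of $X$. A map $\Phi:X\to\exp(X)$ is called upper semi-continuous if it is continuous with respect to the topology on $\exp(X)$ generated by the base consisting of the sets $\{K\in\exp(X):K\subset U\}$, where $U$ runs over the open subsets of $X$. For points $x,y$ of $L$, $[x,y]=\{(1-t)x+ty:t\in[0,1]\}$. A convex subset $X$ of a linear topological space (with the subspace topology) is called upper compactly convex if there is an upper semi-continuous map $\Phi:X\to\exp(X)$ such that $[x,y]\subset\Phi(x)\cup\Phi(y)$ for all $x,y\in X$. *)

theory Defs
  imports "HOL-Analysis.Analysis"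
begin

text \<open>Hausdorff real topological vector spaces. Joint continuity of scalar multiplication is
  phrased with filters, in the style of \<^class>\<open>topological_monoid_add\<close>.\<close>

class linear_topological_space = real_vector + topological_ab_group_add + t2_space +
  assumes tendsto_scaleR_Pair:
    "LIM p (nhds r \<times>\<^sub>F nhds x). fst p *\<^sub>R snd p :> nhds (r *\<^sub>R x)"

instance real_normed_vector \<subseteq> linear_topological_space
proof
  fix r :: real and x :: 'a
  have "(fst \<longlongrightarrow> r) (nhds r \<times>\<^sub>F nhds x)" "(snd \<longlongrightarrow> x) (nhds r \<times>\<^sub>F nhds x)"
    by (rule filterlim_fst filterlim_snd)+
  then show "LIM p (nhds r \<times>\<^sub>F nhds x). fst p *\<^sub>R snd p :> nhds (r *\<^sub>R x)"
    by (rule tendsto_scaleR)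
qed

definition compact_hyperspace :: "'a topology \<Rightarrow> 'a set set" where
  "compact_hyperspace T = {K. compactin T K \<and> K \<noteq> {}}"

definition upper_topology :: "'a topology \<Rightarrow> 'a set topology" where
  "upper_topology T =
     topology_generated_by {{K \<in> compact_hyperspace T. K \<subseteq> U} | U. openin T U}"

lemma topspace_upper_topology: "topspace (upper_topology T) = compact_hyperspace T"
proof -
  have "{K \<in> compact_hyperspace T. K \<subseteq> topspace T} = compact_hyperspace T"
    by (auto simp: compact_hyperspace_def dest: compactin_subset_topspace)
  then have "compact_hyperspace T \<in> {{K \<in> compact_hyperspace T. K \<subseteq> U} | U. openin T U}"
    using openin_topspace[of T] by (intro CollectI exI[of _ "topspace T"]) simp
  then show ?thesis
    unfolding upper_topology_def topology_generated_by_topspace by blast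
qed

definition upper_semicontinuous_map :: "'a topology \<Rightarrow> ('a \<Rightarrow> 'a set) \<Rightarrow> bool" where
  "upper_semicontinuous_map T \<Phi> \<longleftrightarrow> continuous_map T (upper_topology T) \<Phi>"

definition upper_compactly_convex :: "'a::linear_topological_space set \<Rightarrow> bool" where
  "upper_compactly_convex X \<longleftrightarrow> convex X \<and>
     (\<exists>\<Phi>. upper_semicontinuous_map (top_of_set X) \<Phi> \<and>
          (\<forall>x\<in>X. \<forall>y\<in>X. closed_segment x y \<subseteq> \<Phi> x \<union> \<Phi> y))"

end

theory Submission
  imports Defs
begin

text \<open>Only the passage from compact subsets to the closure has content. Let \<Phi> witness upper compact
  convexity. If X itself is compact, it is closed and there is nothing to do. Otherwise fix a point
  \<open>x0\<close> of X; the compact set \<open>\<Phi> x0\<close> omits some \<open>y \<in> X\<close>, and being closed it also omits a point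
  \<open>p = (1 - t) x0 + t y\<close> with \<open>0 < t < 1\<close>. Upper semi-continuity keeps \<open>\<Phi> x\<close> away from a
  neighbourhood of p for all x close to \<open>x0\<close>. The point \<open>(1 - t) x + t y\<close> of the segment from x to y
  lies in that neighbourhood, so it has to be covered by the other set, the fixed compact \<open>\<Phi> y\<close>.
  Thus near \<open>x0\<close> the set X is contained in the preimage of \<open>\<Phi> y\<close> under an affine homeomorphism of
  the whole space, which is compact and metrizable
  (lemma \<open>neighbourhood_in_affine_vimage\<close>).

  Convexity spreads this information from \<open>x0\<close> over the closure: the contractions towards \<open>x0\<close> with
  ratio \<open>1 / (n + 1)\<close> map X into itself and bring every point eventually close to \<open>x0\<close>. Pulling back
  along them covers the closure by countably many relatively open sets, each inside a compact
  metrizable set (lemma \<open>metrizable_closure_if_locally_compact_metrizable_at_point\<close>).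

  A Hausdorff space with such a cover is locally compact, hence regular, and second countable, so it
  is metrizable by Urysohn's metrization theorem.\<close>

section \<open>Urysohn's metrization theorem and countable covers\<close>

lemma compact_metrizable_imp_second_countable:
  assumes "compact_space X" "metrizable_space X"
  shows "second_countable X"
proof -
  obtain M d where Md: "Metric_space M d" and X: "X = Metric_space.mtopology M d"
    using assms(2) by (auto simp: metrizable_space_def)
  interpret Metric_space M d by (fact Md)
  have "mtotally_bounded M"
    using assms(1) X compactin_imp_mtotally_bounded by (simp add: compact_space_def)
  then have "\<exists>K. finite K \<and> K \<subseteq> M \<and> M \<subseteq> (\<Union>x\<in>K. mball x (inverse (Suc n)))" for n
    by (simp add: mtotally_bounded_def)
  then obtain K where K: "\<And>n. finite (K n)" "\<And>n. K n \<subseteq> M"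
      "\<And>n. M \<subseteq> (\<Union>x\<in>K n. mball x (inverse (Suc n)))"
    by metis
  define \<B> where "\<B> = (\<Union>n. (\<lambda>x. mball x (inverse (Suc n))) ` K n)"
  show ?thesis
    unfolding second_countable_def
  proof (intro exI[of _ \<B>] conjI ballI allI impI)
    show "countable \<B>"
      unfolding \<B>_def using K(1) by (simp add: countable_finite)
    show "openin X V" if "V \<in> \<B>" for V
      using that by (auto simp: \<B>_def X)
    fix U x
    assume "openin X U \<and> x \<in> U"
    then have "x \<in> M" "\<exists>r>0. mball x r \<subseteq> U"
      by (auto simp: X openin_mtopology)
    then obtain r where "r > 0" "mball x r \<subseteq> U"
      by blast
    obtain n where n: "inverse (Suc n) < r / 2"
      using reals_Archimedean[of "r / 2"] \<open>r > 0\<close> by auto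
    obtain k where k: "k \<in> K n" "x \<in> mball k (inverse (Suc n))"
      using K(3)[of n] \<open>x \<in> M\<close> by blast
    have "mball k (inverse (Suc n)) \<subseteq> mball x r"
    proof
      fix z assume "z \<in> mball k (inverse (Suc n))"
      then have "z \<in> M" "k \<in> M" "d k z < r / 2" "d k x < r / 2"
        using k n by auto
      then show "z \<in> mball x r"
        using triangle[of x k z] commute[of x k] \<open>x \<in> M\<close> by auto
    qed
    then show "\<exists>V\<in>\<B>. x \<in> V \<and> V \<subseteq> U"
      using k \<open>mball x r \<subseteq> U\<close> unfolding \<B>_def by blast
  qed
qed

text \<open>The space embeds into a countable power of the real line. The coordinates are Urysohn functions, one
  for each of the countably many pairs \<open>(U, V)\<close> of basic open sets with the closure of U inside V;
  regularity provides enough such pairs to separate points from closed sets.\<close>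

lemma Urysohn_metrization:
  assumes reg: "regular_space X" and haus: "Hausdorff_space X" and sec: "second_countable X"
  shows "metrizable_space X"
proof -
  obtain \<B> where "countable \<B>" and op: "\<And>V. V \<in> \<B> \<Longrightarrow> openin X V"
    and base: "\<And>U x. openin X U \<Longrightarrow> x \<in> U \<Longrightarrow> \<exists>V\<in>\<B>. x \<in> V \<and> V \<subseteq> U"
    using sec by (auto simp: second_countable_def)
  define I where "I = {(U, V). U \<in> \<B> \<and> V \<in> \<B> \<and> X closure_of U \<subseteq> V}"
  have "countable I"
    by (rule countable_subset[of _ "\<B> \<times> \<B>"]) (use \<open>countable \<B>\<close> in \<open>auto simp: I_def\<close>)
  have "normal_space X"
    using regular_Lindelof_imp_normal_space second_countable_imp_Lindelof_space reg sec by blast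
  have "\<exists>f. continuous_map X euclideanreal f \<and>
      f ` (X closure_of fst i) \<subseteq> {0} \<and> f ` (topspace X - snd i) \<subseteq> {1}" if "i \<in> I" for i
  proof -
    have "closedin X (topspace X - snd i)" "disjnt (X closure_of fst i) (topspace X - snd i)"
      using that op by (auto simp: I_def disjnt_iff)
    then show ?thesis
      using \<open>normal_space X\<close> closedin_closure_of[of X "fst i"] unfolding normal_space_iff_Urysohn_alt by blast
  qed
  then have "\<forall>i\<in>I. \<exists>f. continuous_map X euclideanreal f \<and>
      f ` (X closure_of fst i) \<subseteq> {0} \<and> f ` (topspace X - snd i) \<subseteq> {1}"
    by blast
  from bchoice[OF this] obtain f where f: "\<forall>i\<in>I. continuous_map X euclideanreal (f i) \<and>
      f i ` (X closure_of fst i) \<subseteq> {0} \<and> f i ` (topspace X - snd i) \<subseteq> {1}"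
    by blast
  have cont: "continuous_map X euclideanreal (f i)" if "i \<in> I" for i
    using f that by simp
  have f0: "f i x = 0" if "i \<in> I" "x \<in> X closure_of fst i" for i x
    using f that by (simp add: image_subset_iff)
  have f1: "f i x = 1" if "i \<in> I" "x \<in> topspace X - snd i" for i x
    using f that by (simp add: image_subset_iff)
  \<comment> \<open>Regularity puts a closed neighbourhood C of x inside a basic set V contained in W; a basic set U
    around x and inside C makes \<open>(U, V)\<close> an admissible index.\<close>
  have sep: "\<exists>i\<in>I. f i x = 0 \<and> (\<forall>y \<in> topspace X - W. f i y = 1)" if W: "openin X W" "x \<in> W" for x W
  proof -
    obtain V where V: "V \<in> \<B>" "x \<in> V" "V \<subseteq> W"
      using base W by blast
    have "neighbourhood_base_of (closedin X) X"
      using reg by (simp add: neighbourhood_base_of_closedin)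
    then have "\<exists>A C. openin X A \<and> closedin X C \<and> x \<in> A \<and> A \<subseteq> C \<and> C \<subseteq> V"
      using op[OF V(1)] V(2) unfolding neighbourhood_base_of by simp
    then obtain A C where AC: "openin X A" "closedin X C" "x \<in> A" "A \<subseteq> C" "C \<subseteq> V"
      by blast
    obtain U where U: "U \<in> \<B>" "x \<in> U" "U \<subseteq> A"
      using base[OF AC(1,3)] by blast
    have "X closure_of U \<subseteq> V"
      using closure_of_minimal[of U C X] U AC by blast
    moreover have "x \<in> X closure_of U"
      using closure_of_subset[of U X] openin_subset[OF op[OF U(1)]] U by blast
    ultimately have "(U, V) \<in> I" "f (U, V) x = 0"
      using f0[of "(U, V)" x] U(1) V(1) by (auto simp: I_def)
    then show ?thesis
      using V(3) f1[of "(U, V)"] by (intro bexI[of _ "(U, V)"]) auto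
  qed
  define P where "P = product_topology (\<lambda>i. euclideanreal) I"
  define e where "e x = (\<lambda>i\<in>I. f i x)" for x
  have cont_e: "continuous_map X P e"
    unfolding P_def e_def by (auto simp: continuous_map_componentwise cont)
  have "homeomorphic_map X (subtopology P (e ` topspace X)) e"
  proof (rule bijective_open_imp_homeomorphic_map)
    show "continuous_map X (subtopology P (e ` topspace X)) e"
      using cont_e by (auto simp: continuous_map_in_subtopology)
    show "e ` topspace X = topspace (subtopology P (e ` topspace X))"
      using continuous_map_image_subset_topspace[OF cont_e] by auto
    show "inj_on e (topspace X)"
    proof (rule inj_onI, rule ccontr)
      fix x y assume xy: "x \<in> topspace X" "y \<in> topspace X" "e x = e y" "x \<noteq> y"
      then have "\<exists>W V. openin X W \<and> openin X V \<and> x \<in> W \<and> y \<in> V \<and> disjnt W V"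
        using haus unfolding Hausdorff_space_def by simp
      then obtain W where W: "openin X W" "x \<in> W" "y \<notin> W"
        unfolding disjnt_iff by blast
      obtain i where "i \<in> I" "f i x = 0" "f i y = 1"
        using sep[OF W(1,2)] xy(2) W(3) by auto
      then show False
        using fun_cong[OF xy(3), of i] by (simp add: e_def)
    qed
    show "open_map X (subtopology P (e ` topspace X)) e"
      unfolding open_map_def
    proof (intro allI impI)
      fix W assume W: "openin X W"
      show "openin (subtopology P (e ` topspace X)) (e ` W)"
      proof (subst openin_subopen, rule ballI)
        fix z assume "z \<in> e ` W"
        then obtain x where x: "x \<in> W" "z = e x" by blast
        obtain i where i: "i \<in> I" "f i x = 0" "\<forall>y \<in> topspace X - W. f i y = 1"
          using sep[OF W x(1)] by auto
        \<comment> \<open>The coordinate \<open>i\<close> is below 1 at \<open>x\<close> and equal to 1 off \<open>W\<close>, so it cuts out of the image an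
          open set around \<open>e x\<close> that lies in \<open>e ` W\<close>.\<close>
        have "openin P {g \<in> topspace P. g i \<in> {..<1}}"
          using i(1) unfolding P_def
          by (intro openin_continuous_map_preimage[OF continuous_map_product_projection]) auto
        then have "openin (subtopology P (e ` topspace X)) (e ` topspace X \<inter> {g \<in> topspace P. g i \<in> {..<1}})"
          by (rule openin_subtopology_Int2)
        moreover have "z \<in> e ` topspace X \<inter> {g \<in> topspace P. g i \<in> {..<1}}"
          using x i openin_subset[OF W] continuous_map_image_subset_topspace[OF cont_e]
          by (auto simp: e_def)
        moreover have "e ` topspace X \<inter> {g \<in> topspace P. g i \<in> {..<1}} \<subseteq> e ` W"
          using i by (force simp: e_def)
        ultimately show "\<exists>T. openin (subtopology P (e ` topspace X)) T \<and> z \<in> T \<and> T \<subseteq> e ` W"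
          by blast
      qed
    qed
  qed
  then have "X homeomorphic_space subtopology P (e ` topspace X)"
    using homeomorphic_map_imp_homeomorphic_space by blast
  moreover have "metrizable_space P"
    unfolding P_def metrizable_space_product_topology
    using \<open>countable I\<close> by (auto intro: countable_subset metrizable_space_euclidean)
  ultimately show ?thesis
    using homeomorphic_metrizable_space metrizable_space_subtopology by blast
qed

lemma second_countable_countable_open_cover:
  assumes cover: "topspace X \<subseteq> (\<Union>n::nat. U n)"
    and op: "\<And>n. openin X (U n)"
    and sec: "\<And>n. second_countable (subtopology X (U n))"
  shows "second_countable X"
proof -
  have "\<exists>\<B>. countable \<B> \<and> (\<forall>V\<in>\<B>. openin (subtopology X (U n)) V) \<and>
      (\<forall>W x. openin (subtopology X (U n)) W \<and> x \<in> W \<longrightarrow> (\<exists>V\<in>\<B>. x \<in> V \<and> V \<subseteq> W))" for n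
    using sec[of n] by (simp add: second_countable_def)
  then obtain \<B> where \<B>: "\<And>n. countable (\<B> n)"
      "\<And>n V. V \<in> \<B> n \<Longrightarrow> openin (subtopology X (U n)) V"
      "\<And>n W x. openin (subtopology X (U n)) W \<Longrightarrow> x \<in> W \<Longrightarrow> \<exists>V\<in>\<B> n. x \<in> V \<and> V \<subseteq> W"
    by metis
  show ?thesis
    unfolding second_countable_def
  proof (intro exI[of _ "\<Union>n. \<B> n"] conjI ballI allI impI)
    show "countable (\<Union>n. \<B> n)"
      using \<B>(1) by simp
    show "openin X V" if "V \<in> (\<Union>n. \<B> n)" for V
      using that \<B>(2) op openin_trans_full by blast
    fix W x assume W: "openin X W \<and> x \<in> W"
    then obtain n where n: "x \<in> U n"
      using cover openin_subset by blast
    then show "\<exists>V\<in>(\<Union>n. \<B> n). x \<in> V \<and> V \<subseteq> W"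
      using \<B>(3)[of n "U n \<inter> W" x] W openin_subtopology_Int2[of X W "U n"] by blast
  qed
qed

text \<open>Local compactness yields regularity, and the sets \<open>U n\<close> inherit a countable base from the compact
  metrizable sets around them; being open and countably many, they pass it on to the whole space.\<close>

lemma metrizable_space_countable_compact_metrizable_cover:
  assumes haus: "Hausdorff_space X"
    and cover: "topspace X \<subseteq> (\<Union>n::nat. U n)"
    and op: "\<And>n. openin X (U n)"
    and sub: "\<And>n. U n \<subseteq> K n"
    and comp: "\<And>n. compactin X (K n)"
    and met: "\<And>n. metrizable_space (subtopology X (K n))"
  shows "metrizable_space X"
proof (rule Urysohn_metrization)
  have "locally_compact_space X"
    unfolding locally_compact_space_def
  proof
    fix x assume "x \<in> topspace X"
    then obtain n where "x \<in> U n"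
      using cover by blast
    then show "\<exists>U K. openin X U \<and> compactin X K \<and> x \<in> U \<and> U \<subseteq> K"
      using op[of n] comp[of n] sub[of n] by blast
  qed
  then show "regular_space X"
    using haus locally_compact_Hausdorff_imp_regular_space by blast
  have "second_countable (subtopology X (K n))" for n
    using comp met by (simp add: compact_metrizable_imp_second_countable compact_space_subtopology)
  then have "second_countable (subtopology (subtopology X (K n)) (U n))" for n
    by (rule second_countable_subtopology)
  then have "second_countable (subtopology X (U n))" for n
    using sub by (simp add: subtopology_subtopology inf_absorb2)
  then show "second_countable X"
    using second_countable_countable_open_cover[OF cover op] by blast
qed (fact haus)


section \<open>Affine homeomorphisms of linear topological spaces\<close>

lemma tendsto_scaleR_linear_topological:
  fixes g :: "'b \<Rightarrow> 'a::linear_topological_space"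
  assumes "(f \<longlongrightarrow> r) F" "(g \<longlongrightarrow> x) F"
  shows "((\<lambda>z. f z *\<^sub>R g z) \<longlongrightarrow> r *\<^sub>R x) F"
  using filterlim_compose[OF tendsto_scaleR_Pair filterlim_Pair[OF assms]] by simp

lemma continuous_on_affine:
  fixes c :: "'a::linear_topological_space"
  shows "continuous_on S (\<lambda>x. a *\<^sub>R x + c)"
  unfolding continuous_on_def
  by (intro ballI tendsto_add tendsto_scaleR_linear_topological tendsto_const tendsto_ident_at)

lemma affine_vimage_compact_metrizable:
  fixes K :: "'a::linear_topological_space set"
  assumes "a \<noteq> 0" "compact K" "metrizable_space (top_of_set K)"
  shows "compact ((\<lambda>x. a *\<^sub>R x + c) -` K)"
    and "metrizable_space (top_of_set ((\<lambda>x. a *\<^sub>R x + c) -` K))"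
proof -
  define h where "h x = a *\<^sub>R x + c" for x
  define g where "g x = inverse a *\<^sub>R x + (- (inverse a *\<^sub>R c))" for x
  have hg: "h (g z) = z" "g (h z) = z" for z
    using \<open>a \<noteq> 0\<close> by (simp_all add: h_def g_def algebra_simps)
  have cont: "continuous_on S h" "continuous_on S g" for S
    unfolding h_def g_def by (rule continuous_on_affine)+
  have eq: "(\<lambda>x. a *\<^sub>R x + c) -` K = g ` K"
    unfolding h_def[symmetric] using hg by (auto simp: image_iff) metis
  show "compact ((\<lambda>x. a *\<^sub>R x + c) -` K)"
    unfolding eq using cont(2) assms(2) by (rule compact_continuous_image)
  have "homeomorphic_maps (top_of_set K) (top_of_set (g ` K)) g h"
    using hg cont by (auto simp: homeomorphic_maps_def)
  then show "metrizable_space (top_of_set ((\<lambda>x. a *\<^sub>R x + c) -` K))"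
    unfolding eq
    using assms(3) homeomorphic_metrizable_space homeomorphic_space_def by blast
qed

section \<open>Upper semi-continuous maps and compactly convex sets\<close>

lemma Hausdorff_space_euclidean_t2: "Hausdorff_space (euclidean :: 'a::t2_space topology)"
  unfolding Hausdorff_space_def disjnt_def using hausdorff by auto

lemma upper_semicontinuous_mapD:
  fixes X :: "'a::topological_space set"
  assumes "upper_semicontinuous_map (top_of_set X) \<Phi>"
  shows "x \<in> X \<Longrightarrow> compact (\<Phi> x)" and "x \<in> X \<Longrightarrow> \<Phi> x \<subseteq> X"
    and "open U \<Longrightarrow> openin (top_of_set X) {x \<in> X. \<Phi> x \<subseteq> U}"
proof -
  have cont: "continuous_map (top_of_set X) (upper_topology (top_of_set X)) \<Phi>"
    using assms by (simp add: upper_semicontinuous_map_def)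
  have hyp: "\<Phi> x \<in> compact_hyperspace (top_of_set X)" if "x \<in> X" for x
    using continuous_map_image_subset_topspace[OF cont] that
    by (auto simp: topspace_upper_topology)
  then show comp: "compact (\<Phi> x)" and sub: "\<Phi> x \<subseteq> X" if "x \<in> X" for x
    using that by (auto simp: compact_hyperspace_def compactin_subtopology)
  assume "open U"
  then have "openin (top_of_set X) (X \<inter> U)"
    by (rule openin_open_Int)
  then have "openin (upper_topology (top_of_set X))
      {K \<in> compact_hyperspace (top_of_set X). K \<subseteq> X \<inter> U}"
    unfolding upper_topology_def by (intro topology_generated_by_Basis) blast
  from openin_continuous_map_preimage[OF cont this]
  have "openin (top_of_set X)
      {x \<in> X. \<Phi> x \<in> compact_hyperspace (top_of_set X) \<and> \<Phi> x \<subseteq> X \<inter> U}"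
    by simp
  also have "{x \<in> X. \<Phi> x \<in> compact_hyperspace (top_of_set X) \<and> \<Phi> x \<subseteq> X \<inter> U} = {x \<in> X. \<Phi> x \<subseteq> U}"
    using hyp sub by auto
  finally show "openin (top_of_set X) {x \<in> X. \<Phi> x \<subseteq> U}" .
qed

text \<open>The geometric core. A point \<open>(1 - t) x0 + t y\<close> of the segment that \<open>\<Phi> x0\<close> misses is missed, together
  with a neighbourhood P, by all \<open>\<Phi> x\<close> with x near \<open>x0\<close>; so \<open>\<Phi> y\<close> has to cover the points
  \<open>(1 - t) x + t y\<close> for all these x simultaneously.\<close>

lemma neighbourhood_in_affine_vimage:
  fixes X :: "'a::linear_topological_space set"
  assumes usc: "upper_semicontinuous_map (top_of_set X) \<Phi>"
    and seg: "\<And>x y. x \<in> X \<Longrightarrow> y \<in> X \<Longrightarrow> closed_segment x y \<subseteq> \<Phi> x \<union> \<Phi> y"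
    and x0: "x0 \<in> X" and y: "y \<in> X" "y \<notin> \<Phi> x0"
  obtains N t where "open N" "x0 \<in> N" "t < 1" "X \<inter> N \<subseteq> (\<lambda>x. (1 - t) *\<^sub>R x + t *\<^sub>R y) -` \<Phi> y"
proof -
  have comp: "compact (\<Phi> x0)"
    using upper_semicontinuous_mapD(1)[OF usc x0] .
  \<comment> \<open>The set \<open>\<Phi> x0\<close> is closed and omits y, so it omits a point of the segment before y. The strict
    inequality \<open>t < 1\<close> makes the affine map below invertible.\<close>
  have "((\<lambda>t. (1 - t) *\<^sub>R x0 + t *\<^sub>R y) \<longlongrightarrow> (1 - 1) *\<^sub>R x0 + 1 *\<^sub>R y) (at_left (1::real))"
    by (intro tendsto_add tendsto_scaleR_linear_topological tendsto_diff tendsto_const tendsto_ident_at)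
  then have "((\<lambda>t. (1 - t) *\<^sub>R x0 + t *\<^sub>R y) \<longlongrightarrow> y) (at_left (1::real))"
    by simp
  then have "\<forall>\<^sub>F t in at_left 1. (1 - t) *\<^sub>R x0 + t *\<^sub>R y \<in> - \<Phi> x0"
    by (rule topological_tendstoD) (use y comp in \<open>auto simp: open_Compl compact_imp_closed\<close>)
  moreover have "\<forall>\<^sub>F t in at_left (1::real). t \<in> {0<..<1}"
    by (rule eventually_at_left_real) simp
  ultimately have "\<forall>\<^sub>F t in at_left (1::real). (1 - t) *\<^sub>R x0 + t *\<^sub>R y \<in> - \<Phi> x0 \<and> t \<in> {0<..<1}"
    by (rule eventually_conj)
  then obtain t where t: "(1 - t) *\<^sub>R x0 + t *\<^sub>R y \<notin> \<Phi> x0" "0 < t" "t < 1"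
    using eventually_happens'[OF trivial_limit_at_left_real] by auto
  define h where "h = (\<lambda>x. (1 - t) *\<^sub>R x + t *\<^sub>R y)"
  obtain U P where UP: "open U" "open P" "\<Phi> x0 \<subseteq> U" "h x0 \<in> P" "U \<inter> P = {}"
    using Hausdorff_space_compact_separation[of euclidean "\<Phi> x0" "{h x0}"]
      Hausdorff_space_euclidean_t2 comp t
    by (auto simp: disjnt_def h_def)
  have "open (h -` P)"
    unfolding h_def using open_vimage[OF UP(2) continuous_on_affine] .
  moreover obtain M where M: "open M" "{x \<in> X. \<Phi> x \<subseteq> U} = X \<inter> M"
    using upper_semicontinuous_mapD(3)[OF usc UP(1)] by (auto simp: openin_open)
  moreover have "h x \<in> \<Phi> y" if x: "x \<in> X" "x \<in> M" "h x \<in> P" for x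
  proof -
    have "h x \<in> closed_segment x y"
      using t by (auto simp: closed_segment_def h_def)
    moreover have "h x \<notin> \<Phi> x"
      using x M UP by blast
    ultimately show ?thesis
      using seg[OF x(1) y(1)] by blast
  qed
  ultimately have "open (M \<inter> h -` P)" "X \<inter> (M \<inter> h -` P) \<subseteq> h -` \<Phi> y"
    by auto
  moreover have "x0 \<in> M \<inter> h -` P"
    using x0 UP M by auto
  ultimately show thesis
    using that[of "M \<inter> h -` P" t] t unfolding h_def by blast
qed

text \<open>Only one good point is required: the contractions towards \<open>x0\<close> preserve X by convexity and move any
  given point of the space into N eventually, so the preimages of N and C under them form a countable
  cover of the closure of X of the kind considered above.\<close>

lemma metrizable_closure_if_locally_compact_metrizable_at_point:
  fixes X :: "'a::linear_topological_space set"
  assumes "convex X" "x0 \<in> X" "open N" "x0 \<in> N" "X \<inter> N \<subseteq> C"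
    and C: "compact C" "metrizable_space (top_of_set C)"
  shows "metrizable_space (top_of_set (closure X))"
proof -
  define s where "s n = inverse (real (Suc n))" for n
  have s: "0 < s n" "s n \<le> 1" for n
    by (simp_all add: s_def inverse_le_1_iff)
  define h where "h n x = s n *\<^sub>R x + (1 - s n) *\<^sub>R x0" for n x
  have cont: "continuous_on S (h n)" for S n
    unfolding h_def by (rule continuous_on_affine)
  have compact_vimage: "compact (h n -` C)" and metrizable_vimage: "metrizable_space (top_of_set (h n -` C))" for n
    using affine_vimage_compact_metrizable[OF _ C, of "s n" "(1 - s n) *\<^sub>R x0"] s[of n]
    by (simp_all add: h_def[abs_def])
  have op: "open (h n -` N)" for n
    using open_vimage[OF \<open>open N\<close> cont] .
  have lim: "(\<lambda>n. h n x) \<longlonglongrightarrow> x0" for x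
  proof -
    have "(\<lambda>n. h n x) \<longlonglongrightarrow> 0 *\<^sub>R x + (1 - 0) *\<^sub>R x0"
      unfolding h_def s_def
      by (intro tendsto_add tendsto_scaleR_linear_topological tendsto_diff tendsto_const
          LIMSEQ_inverse_real_of_nat)
    then show ?thesis by simp
  qed
  show ?thesis
  proof (rule metrizable_space_countable_compact_metrizable_cover
      [where U = "\<lambda>n. closure X \<inter> h n -` N" and K = "\<lambda>n. closure X \<inter> h n -` C"])
    show "Hausdorff_space (top_of_set (closure X))"
      by (intro Hausdorff_space_subtopology Hausdorff_space_euclidean_t2)
    show "topspace (top_of_set (closure X)) \<subseteq> (\<Union>n. closure X \<inter> h n -` N)"
    proof
      fix x assume "x \<in> topspace (top_of_set (closure X))"
      moreover have "\<exists>n. h n x \<in> N"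
        using topological_tendstoD[OF lim \<open>open N\<close> \<open>x0 \<in> N\<close>] eventually_happens'[OF sequentially_bot]
        by blast
      ultimately show "x \<in> (\<Union>n. closure X \<inter> h n -` N)" by auto
    qed
    show "openin (top_of_set (closure X)) (closure X \<inter> h n -` N)" for n
      using op by (rule openin_open_Int)
    have "X \<inter> h n -` N \<subseteq> h n -` C" for n
    proof
      fix x assume "x \<in> X \<inter> h n -` N"
      then have "h n x \<in> X \<inter> N"
        using convexD[OF \<open>convex X\<close>, of x x0 "s n" "1 - s n"] s[of n] \<open>x0 \<in> X\<close> by (simp add: h_def)
      then show "x \<in> h n -` C"
        using \<open>X \<inter> N \<subseteq> C\<close> by auto
    qed
    \<comment> \<open>The compact set is closed, hence the inclusion survives the passage from X to its closure.\<close>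
    then have "closure (h n -` N \<inter> X) \<subseteq> h n -` C" for n
      using compact_vimage by (intro closure_minimal compact_imp_closed) auto
    then show "closure X \<inter> h n -` N \<subseteq> closure X \<inter> h n -` C" for n
      using open_Int_closure_subset[OF op, of n X] by blast
    show "compactin (top_of_set (closure X)) (closure X \<inter> h n -` C)" for n
      using compact_vimage by (simp add: compactin_subtopology closed_Int_compact)
    show "metrizable_space (subtopology (top_of_set (closure X)) (closure X \<inter> h n -` C))" for n
      using metrizable_space_subtopology[OF metrizable_vimage, of n "closure X"]
      by (simp add: subtopology_subtopology Int_ac)
  qed
qed

theorem corollary2:
  fixes X :: "'a::linear_topological_space set"
  assumes "upper_compactly_convex X"
  shows "metrizable_space (top_of_set (closure X)) \<longleftrightarrow>
         (\<forall>K. K \<subseteq> X \<and> compact K \<longrightarrow> metrizable_space (top_of_set K))"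
proof (intro iffI allI impI)
  fix K assume "metrizable_space (top_of_set (closure X))" "K \<subseteq> X \<and> compact K"
  moreover have "top_of_set K = subtopology (top_of_set (closure X)) K" if "K \<subseteq> X"
    using that closure_subset[of X] by (simp add: subtopology_subtopology inf_absorb2)
  ultimately show "metrizable_space (top_of_set K)"
    by (simp add: metrizable_space_subtopology)
next
  assume met: "\<forall>K. K \<subseteq> X \<and> compact K \<longrightarrow> metrizable_space (top_of_set K)"
  obtain \<Phi> where "convex X" and usc: "upper_semicontinuous_map (top_of_set X) \<Phi>"
    and seg: "\<And>x y. x \<in> X \<Longrightarrow> y \<in> X \<Longrightarrow> closed_segment x y \<subseteq> \<Phi> x \<union> \<Phi> y"
    using assms by (auto simp: upper_compactly_convex_def)
  show "metrizable_space (top_of_set (closure X))"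
  proof (cases "compact X")
    case True
    then show ?thesis
      using met by (simp add: compact_imp_closed)
  next
    case False
    then obtain x0 where x0: "x0 \<in> X"
      by (metis compact_empty equals0I)
    note \<Phi> = upper_semicontinuous_mapD(1,2)[OF usc]
    obtain y where y: "y \<in> X" "y \<notin> \<Phi> x0"
      using \<Phi>[OF x0] False by (metis subset_antisym subsetI)
    obtain N t where N: "open N" "x0 \<in> N" "t < 1"
        "X \<inter> N \<subseteq> (\<lambda>x. (1 - t) *\<^sub>R x + t *\<^sub>R y) -` \<Phi> y"
      by (rule neighbourhood_in_affine_vimage[OF usc seg x0 y])
    have "metrizable_space (top_of_set (\<Phi> y))"
      using met \<Phi>[OF y(1)] by blast
    then show ?thesis
      using affine_vimage_compact_metrizable[of "1 - t" "\<Phi> y"] \<Phi>(1)[OF y(1)] N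
      by (intro metrizable_closure_if_locally_compact_metrizable_at_point[OF \<open>convex X\<close> x0 N(1,2,4)])
        auto
  qed
qed

end
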